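(* Let $t, h, x, y, z \in \mathbb{R}$. Then $(t, h, x, y, z)$ is a non-trivial solution of the equation $$\sqrt{t \left(\frac{1}{h^2}-\frac{1}{x^2}\right)\left(\frac{1}{h^2}-\frac{1}{y^2}\right)\left(\frac{1}{h^2}-\frac{1}{z^2}\right)} \;=\; \left(\frac{1}{h}+\frac{1}{x}\right)\left(\frac{1}{h}+\frac{1}{y}\right)\left(\frac{1}{h}+\frac{1}{z}\right)$$ if and only if $t \neq 0$, $h \neq 0$, $z \neq 0$, $z \neq \pm h$, and there exists a real number $m \neq 0$ such that, setting $$\gamma = mt(z-h) - m(z+h), \qquad \beta = hmt(z-h) + hm(z+h) - h^2,$$ we have $$\gamma^2 - 4\beta \ge 0 \quad\text{and}\quad (h^2 + h\gamma + \beta)\,\beta\left(\frac{1}{h}+\frac{1}{z}\right) > 0,$$ and $x$ and $y$ are the two roots of $X^2 - \gamma X + \beta = 0$ (i.e., $x + y = \gamma$ and $xy = \beta$).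
   Context: Here $\sqrt{\cdot}$ denotes the nonnegative real square root, so the equation is understood with its radicand a nonnegative real number. A solution $(t,h,x,y,z)\in\mathbb{R}^5$ of the equation is called non-trivial if $t, h, x, y, z \neq 0$ and $x, y, z \neq \pm h$. *)

theory Defs
  imports Complex_Main
begin

definition radicand :: "real \<Rightarrow> real \<Rightarrow> real \<Rightarrow> real \<Rightarrow> real \<Rightarrow> real" where
  "radicand t h x y z =
     t * (1 / h^2 - 1 / x^2) * (1 / h^2 - 1 / y^2) * (1 / h^2 - 1 / z^2)"

text \<open>
  Isabelle's \<^const>\<open>sqrt\<close> is total and odd (\<^prop>\<open>sqrt (- a) = - sqrt a\<close>), and \<^prop>\<open>a / 0 = 0\<close>
  for every real \<open>a\<close>.  Well-definedness of the equation, i.e. nonzero denominators and a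
  nonnegative radicand, is therefore part of being a solution.
\<close>

definition is_solution :: "real \<Rightarrow> real \<Rightarrow> real \<Rightarrow> real \<Rightarrow> real \<Rightarrow> bool" where
  "is_solution t h x y z \<longleftrightarrow>
     h \<noteq> 0 \<and> x \<noteq> 0 \<and> y \<noteq> 0 \<and> z \<noteq> 0 \<and>
     radicand t h x y z \<ge> 0 \<and>
     sqrt (radicand t h x y z) = (1 / h + 1 / x) * (1 / h + 1 / y) * (1 / h + 1 / z)"

definition nontrivial_solution :: "real \<Rightarrow> real \<Rightarrow> real \<Rightarrow> real \<Rightarrow> real \<Rightarrow> bool" where
  "nontrivial_solution t h x y z \<longleftrightarrow>
     is_solution t h x y z \<and>
     t \<noteq> 0 \<and> h \<noteq> 0 \<and> x \<noteq> 0 \<and> y \<noteq> 0 \<and> z \<noteq> 0 \<and>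
     x \<noteq> h \<and> x \<noteq> - h \<and> y \<noteq> h \<and> y \<noteq> - h \<and> z \<noteq> h \<and> z \<noteq> - h"

end

theory Submission imports Defs begin

text \<open>
  Put \<open>P = (x + h) (y + h)\<close> and \<open>Q = (x - h) (y - h)\<close>. After cancelling \<open>P (z + h)\<close>, the squared
  equation reads \<open>t Q (z - h) = P (z + h)\<close>; equivalently \<open>P = 2 h m t (z - h)\<close> and
  \<open>Q = 2 h m (z + h)\<close> for some \<open>m\<close>, and solving these for \<open>x + y\<close> and \<open>x y\<close> gives \<open>\<gamma>\<close> and \<open>\<beta>\<close>.
  The remaining sign condition says that the right-hand side of the equation is positive.
\<close>

text \<open>The common denominator is the square of the one in \<open>rhs_eq\<close>, and the
  factors are grouped so that the numerator of the right-hand side can be cancelled.\<close>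

lemma radicand_eq:
  assumes "h \<noteq> 0" "x \<noteq> 0" "y \<noteq> 0" "z \<noteq> 0"
  shows "radicand t h x y z =
    t * ((x + h) * (y + h)) * ((x - h) * (y - h)) * ((z + h) * (z - h)) / (h^3 * x * y * z)^2"
proof -
  have factor: "1 / h^2 - 1 / w^2 = (w + h) * (w - h) / (h * w)^2" if "w \<noteq> 0" for w
    using assms(1) that by (simp add: divide_simps) algebra
  have "radicand t h x y z = t * ((x + h) * (x - h) / (h * x)^2) *
      ((y + h) * (y - h) / (h * y)^2) * ((z + h) * (z - h) / (h * z)^2)"
    unfolding radicand_def factor[OF assms(2)] factor[OF assms(3)] factor[OF assms(4)] ..
  then show ?thesis
    by (simp add: power2_eq_square power3_eq_cube mult_ac)
qed

lemma rhs_eq: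
  fixes h x y z :: real
  assumes "h \<noteq> 0" "x \<noteq> 0" "y \<noteq> 0" "z \<noteq> 0"
  shows "(1 / h + 1 / x) * (1 / h + 1 / y) * (1 / h + 1 / z) =
    (x + h) * (y + h) * (z + h) / (h^3 * x * y * z)"
  using assms by (simp add: divide_simps power3_eq_cube)

text \<open>Multiplying by the positive square \<open>(h * x * y)^2\<close> clears the denominators
  in \<open>x\<close> and \<open>y\<close>; \<open>1 / h + 1 / z\<close> is kept as it occurs in the
  target sign condition.\<close>

lemma rhs_pos_iff:
  fixes h x y z :: real
  assumes "h \<noteq> 0" "x \<noteq> 0" "y \<noteq> 0"
  shows "(1 / h + 1 / x) * (1 / h + 1 / y) * (1 / h + 1 / z) > 0 \<longleftrightarrow>
    (x + h) * (y + h) * (x * y) * (1 / h + 1 / z) > 0"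
proof -
  have "(x + h) * (y + h) * (x * y) * (1 / h + 1 / z) =
      (h * x * y)^2 * ((1 / h + 1 / x) * (1 / h + 1 / y) * (1 / h + 1 / z))"
    using assms by (simp add: field_simps power2_eq_square)
  moreover have "(h * x * y)^2 > 0"
    using assms by simp
  ultimately show ?thesis
    by (metis zero_less_mult_pos zero_less_mult_pos2 mult_pos_pos)
qed

lemma sqrt_eq_pos_iff:
  fixes r c :: real
  assumes "c \<noteq> 0"
  shows "r \<ge> 0 \<and> sqrt r = c \<longleftrightarrow> c > 0 \<and> r = c^2"
  using assms by (auto simp: real_sqrt_unique less_le)

text \<open>Removes the square root: with right-hand side \<open>N / D\<close> and radicand
  \<open>M * N / D^2\<close>, squaring gives \<open>M * N = N^2\<close>, and \<open>N\<close>
  cancels.\<close>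

lemma nontrivial_solution_iff:
  "nontrivial_solution t h x y z \<longleftrightarrow>
    t \<noteq> 0 \<and> h \<noteq> 0 \<and> x \<noteq> 0 \<and> y \<noteq> 0 \<and> z \<noteq> 0 \<and>
    x \<noteq> h \<and> x \<noteq> - h \<and> y \<noteq> h \<and> y \<noteq> - h \<and> z \<noteq> h \<and> z \<noteq> - h \<and>
    (x + h) * (y + h) * (x * y) * (1 / h + 1 / z) > 0 \<and>
    t * ((x - h) * (y - h)) * (z - h) = (x + h) * (y + h) * (z + h)"
  (is "_ \<longleftrightarrow> ?R")
\<comment> \<open>These conditions make \<open>N\<close> and \<open>D\<close> nonzero; if one of
  them fails, both sides are false.\<close>
proof (cases "h \<noteq> 0 \<and> x \<noteq> 0 \<and> y \<noteq> 0 \<and> z \<noteq> 0 \<and> x \<noteq> - h \<and> y \<noteq> - h \<and> z \<noteq> - h")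
  case True
  define N where "N = (x + h) * (y + h) * (z + h)"
  define M where "M = t * ((x - h) * (y - h)) * (z - h)"
  define D where "D = h^3 * x * y * z"
  define c where "c = (1 / h + 1 / x) * (1 / h + 1 / y) * (1 / h + 1 / z)"
  have "N \<noteq> 0" "D \<noteq> 0"
    using True by (simp_all add: N_def D_def add_eq_0_iff2)
  moreover have c: "c = N / D"
    using rhs_eq[of h x y z] True by (simp add: c_def N_def D_def)
  moreover have "radicand t h x y z = M * N / D^2"
    using radicand_eq[of h x y z t] True by (simp add: M_def N_def D_def mult_ac)
  ultimately have "radicand t h x y z = c^2 \<longleftrightarrow> M = N" and "c \<noteq> 0"
    by (simp_all add: power_divide power2_eq_square)
  then have "radicand t h x y z \<ge> 0 \<and> sqrt (radicand t h x y z) = c \<longleftrightarrow> c > 0 \<and> M = N"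
    by (simp add: sqrt_eq_pos_iff)
  moreover have "c > 0 \<longleftrightarrow> (x + h) * (y + h) * (x * y) * (1 / h + 1 / z) > 0"
    unfolding c_def by (rule rhs_pos_iff) (use True in auto)
  ultimately show ?thesis
    using True unfolding nontrivial_solution_def is_solution_def M_def N_def c_def by blast
next
  case False
  then show ?thesis
    unfolding nontrivial_solution_def is_solution_def by blast
qed

theorem theorem1:
  fixes t h x y z :: real
  shows "nontrivial_solution t h x y z \<longleftrightarrow>
    t \<noteq> 0 \<and> h \<noteq> 0 \<and> z \<noteq> 0 \<and> z \<noteq> h \<and> z \<noteq> - h \<and>
    (\<exists>m::real. m \<noteq> 0 \<and>
      (let \<gamma> = m * t * (z - h) - m * (z + h);
           \<beta> = h * m * t * (z - h) + h * m * (z + h) - h^2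
       in \<gamma>^2 - 4 * \<beta> \<ge> 0 \<and>
          (h^2 + h * \<gamma> + \<beta>) * \<beta> * (1 / h + 1 / z) > 0 \<and>
          x + y = \<gamma> \<and> x * y = \<beta>))"
proof -
  define P where "P = (x + h) * (y + h)"
  define Q where "Q = (x - h) * (y - h)"
  have params: "(let \<gamma> = m * t * (z - h) - m * (z + h);
           \<beta> = h * m * t * (z - h) + h * m * (z + h) - h^2
       in \<gamma>^2 - 4 * \<beta> \<ge> 0 \<and>
          (h^2 + h * \<gamma> + \<beta>) * \<beta> * (1 / h + 1 / z) > 0 \<and>
          x + y = \<gamma> \<and> x * y = \<beta>) \<longleftrightarrow>
      P = 2 * h * m * t * (z - h) \<and> Q = 2 * h * m * (z + h) \<and>
      P * (x * y) * (1 / h + 1 / z) > 0" (is "?L \<longleftrightarrow> ?R") if "h \<noteq> 0" for m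
  proof -
    define g where "g = m * t * (z - h) - m * (z + h)"
    define b where "b = h * m * t * (z - h) + h * m * (z + h) - h^2"
    have sums: "x + y = g \<and> x * y = b \<longleftrightarrow>
        P = 2 * h * m * t * (z - h) \<and> Q = 2 * h * m * (z + h)"
    proof
      assume "x + y = g \<and> x * y = b"
      then show "P = 2 * h * m * t * (z - h) \<and> Q = 2 * h * m * (z + h)"
        unfolding P_def Q_def g_def b_def by algebra
    next
      assume PQ: "P = 2 * h * m * t * (z - h) \<and> Q = 2 * h * m * (z + h)"
      \<comment> \<open>\<open>P - Q = 2 * h * (x + y)\<close> and
        \<open>P + Q = 2 * (x * y + h^2)\<close>; the factor \<open>2 * h\<close> is cancelled
        afterwards.\<close>
      then have "2 * h * (x + y) = 2 * h * g" "x * y = b"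
        unfolding P_def Q_def g_def b_def by algebra+
      with that show "x + y = g \<and> x * y = b" by simp
    qed
    \<comment> \<open>The discriminant is a square because \<open>x\<close> and \<open>y\<close> are
      real, so only the sign condition remains, with \<open>P\<close> as its first factor.\<close>
    have "P = h^2 + h * (x + y) + x * y" "(x + y)^2 - 4 * (x * y) = (x - y)^2"
      unfolding P_def by algebra+
    then have "g^2 - 4 * b \<ge> 0 \<and> (h^2 + h * g + b) * b * (1 / h + 1 / z) > 0 \<longleftrightarrow>
        P * (x * y) * (1 / h + 1 / z) > 0" if "x + y = g" "x * y = b"
      using that by simp
    with sums show ?thesis
      unfolding Let_def g_def[symmetric] b_def[symmetric] by blast
  qed
  have param: "(\<exists>m. m \<noteq> 0 \<and> P = 2 * h * m * t * (z - h) \<and> Q = 2 * h * m * (z + h)) \<longleftrightarrow>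
      Q \<noteq> 0 \<and> t * Q * (z - h) = P * (z + h)" if "h \<noteq> 0" "z \<noteq> - h"
  proof
    assume "\<exists>m. m \<noteq> 0 \<and> P = 2 * h * m * t * (z - h) \<and> Q = 2 * h * m * (z + h)"
    then show "Q \<noteq> 0 \<and> t * Q * (z - h) = P * (z + h)"
      using that by (auto simp: add_eq_0_iff2)
  next
    assume *: "Q \<noteq> 0 \<and> t * Q * (z - h) = P * (z + h)"
    have "z + h \<noteq> 0" using that by (simp add: add_eq_0_iff2)
    moreover have "P * ((z + h) * 2) = Q * (t * ((z - h) * 2))"
      using * by (simp add: algebra_simps)
    \<comment> \<open>The witness for \<open>m\<close> comes from solving
      \<open>Q = 2 * h * m * (z + h)\<close>; it is nonzero because \<open>Q\<close> is.\<close>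
    ultimately have "Q / (2 * h * (z + h)) \<noteq> 0"
      and "P = 2 * h * (Q / (2 * h * (z + h))) * t * (z - h)"
      and "Q = 2 * h * (Q / (2 * h * (z + h))) * (z + h)"
      using * that by (simp_all add: nonzero_eq_divide_eq mult_ac)
    then show "\<exists>m. m \<noteq> 0 \<and> P = 2 * h * m * t * (z - h) \<and> Q = 2 * h * m * (z + h)"
      by blast
  qed
  \<comment> \<open>This recovers non-triviality in \<open>x\<close> and \<open>y\<close>: strict
    positivity excludes \<open>0\<close> and, through \<open>P\<close>, the value
    \<open>- h\<close>, while \<open>Q \<noteq> 0\<close> (that is, \<open>m \<noteq> 0\<close>)
    excludes \<open>h\<close>.\<close>
  have nz: "P * (x * y) * (1 / h + 1 / z) > 0 \<and> Q \<noteq> 0 \<longleftrightarrow>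
      P * (x * y) * (1 / h + 1 / z) > 0 \<and>
      x \<noteq> 0 \<and> y \<noteq> 0 \<and> x \<noteq> h \<and> x \<noteq> - h \<and> y \<noteq> h \<and> y \<noteq> - h"
    by (auto simp: P_def Q_def)
  show ?thesis
    unfolding nontrivial_solution_iff P_def[symmetric] Q_def[symmetric]
    using params param nz by (smt (verit, ccfv_threshold))
qed

end
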